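(* Let $V$ be a countably infinite set, let $k:V\times V\to\mathbb{R}$ be a real-valued positive definite function with reproducing kernel Hilbert space $\mathscr{H}=\mathscr{H}(k)$, and assume $\delta_x\in\mathscr{H}$ for all $x\in V$. Consider the infinite matrices indexed by $V\times V$: $$D_{xy}:=\langle\delta_x,\delta_y\rangle_{\mathscr{H}},\qquad K_{xy}:=k(x,y),$$ and $C=(C_{xy})$ such that $\delta_x=\sum_{y\in V}C_{xy}k_y$ for every $x\in V$ (convergence in $\mathscr{H}$). Then $$D=C^{tr}=(K^{tr})^{-1}=K^{-1}.$$
   Context: Positive definite means $\sum_{(x,y)\in F\times F}k(x,y)\overline{c_x}c_y\ge 0$ for all finite $F\subset V$ and all complex $c_x$. Write $k_x:=k(\cdot,x)$; $\mathscr{H}(k)$ is the Hilbert space of functions on $V$ obtained by completing $\mathrm{span}\{k_x\}$ with $\langle k_x,k_y\rangle_{\mathscr{H}}=k(x,y)$ (inner product conjugate linear in the first variable), and $\langle k_x,f\rangle_{\mathscr{H}}=f(x)$ for $f\in\mathscr{H}$. $\delta_x$ is the function equal to $1$ at $x$ and $0$ elsewhere. Matrices are infinite square matrices with rows and columns indexed by $V$; $tr$ denotes transpose; infinite sums (including those in matrix products and in the expansion defining $C$) are understood as limits of finite partial sums along the directed set of finite subsets of $V$. With $I=(\delta_{xy})$ the identity matrix, the assertion that a matrix $M$ equals $K^{-1}$ means $MK=KM=I$ entrywise (and similarly for $K^{tr}$). *)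

theory Defs
  imports
    "HOL-Analysis.Analysis"
    "HOL-Library.Function_Algebras"
    "HOL-Library.Nonpos_Ints"
begin

text \<open>The index set \<open>V\<close> is the universe of a type \<open>'v\<close>; complex functions on \<open>V\<close> form a
  complex vector space under the pointwise operations.\<close>

definition fscale :: "complex \<Rightarrow> ('v \<Rightarrow> complex) \<Rightarrow> 'v \<Rightarrow> complex" where
  "fscale c f = (\<lambda>x. c * f x)"

lemma vector_space_fscale: "vector_space (fscale :: complex \<Rightarrow> ('v \<Rightarrow> complex) \<Rightarrow> _)"
  by unfold_locales (auto simp: fscale_def fun_eq_iff algebra_simps)

definition delta :: "'v \<Rightarrow> 'v \<Rightarrow> complex" where
  "delta x = (\<lambda>y. of_bool (y = x))"

definition kernel_section :: "('v \<Rightarrow> 'v \<Rightarrow> real) \<Rightarrow> 'v \<Rightarrow> 'v \<Rightarrow> complex" where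
  "kernel_section k x = (\<lambda>y. complex_of_real (k y x))"

text \<open>Membership in \<open>\<real>\<^sub>\<ge>\<^sub>0\<close> says that the complex number on the left is real and nonnegative.
  As all complex coefficients are allowed, this forces \<open>k\<close> to be symmetric.\<close>

definition positive_definite_kernel :: "('v \<Rightarrow> 'v \<Rightarrow> real) \<Rightarrow> bool" where
  "positive_definite_kernel k \<longleftrightarrow>
    (\<forall>(F :: 'v set) (c :: 'v \<Rightarrow> complex). finite F \<longrightarrow>
      (\<Sum>(x, y)\<in>F \<times> F. complex_of_real (k x y) * cnj (c x) * c y) \<in> \<real>\<^sub>\<ge>\<^sub>0)"

text \<open>The norm is meaningful only on the carrier \<open>H\<close> of an inner product \<open>ip\<close>;
  nothing is known about \<open>ip\<close> outside \<open>H\<close>.\<close>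

definition ip_norm :: "(('v \<Rightarrow> complex) \<Rightarrow> ('v \<Rightarrow> complex) \<Rightarrow> complex) \<Rightarrow> ('v \<Rightarrow> complex) \<Rightarrow> real" where
  "ip_norm ip f = sqrt (Re (ip f f))"

locale function_hilbert_space =
  fixes H :: "('v \<Rightarrow> complex) set"
    and ip :: "('v \<Rightarrow> complex) \<Rightarrow> ('v \<Rightarrow> complex) \<Rightarrow> complex"
  assumes subspace: "module.subspace fscale H"
    and ip_add_right: "\<lbrakk>f \<in> H; g \<in> H; h \<in> H\<rbrakk> \<Longrightarrow> ip f (g + h) = ip f g + ip f h"
    and ip_scale_right: "\<lbrakk>f \<in> H; g \<in> H\<rbrakk> \<Longrightarrow> ip f (fscale c g) = c * ip f g"
    and ip_commute: "\<lbrakk>f \<in> H; g \<in> H\<rbrakk> \<Longrightarrow> ip g f = cnj (ip f g)"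
    and ip_nonneg: "f \<in> H \<Longrightarrow> ip f f \<in> \<real>\<^sub>\<ge>\<^sub>0"
    and ip_eq_zero: "\<lbrakk>f \<in> H; ip f f = 0\<rbrakk> \<Longrightarrow> f = 0"
    and complete:
      "\<lbrakk>\<And>n. u n \<in> H; \<And>e. e > 0 \<Longrightarrow> \<exists>N. \<forall>m\<ge>N. \<forall>n\<ge>N. ip_norm ip (u m - u n) < e\<rbrakk>
        \<Longrightarrow> \<exists>f\<in>H. (\<lambda>n. ip_norm ip (u n - f)) \<longlonglongrightarrow> 0"

text \<open>\<open>rkhs k H ip\<close> says that \<open>(H, ip)\<close> is the completion, as a space of functions, of the span of
  the sections of \<open>k\<close> with the inner product given on sections by \<open>k\<close>. These conditions determine
  \<open>H\<close>, and \<open>ip\<close> on \<open>H \<times> H\<close>, uniquely.\<close>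

locale rkhs = function_hilbert_space H ip
  for k :: "'v \<Rightarrow> 'v \<Rightarrow> real"
    and H :: "('v \<Rightarrow> complex) set"
    and ip :: "('v \<Rightarrow> complex) \<Rightarrow> ('v \<Rightarrow> complex) \<Rightarrow> complex" +
  assumes section_mem: "kernel_section k x \<in> H"
    and ip_sections: "ip (kernel_section k x) (kernel_section k y) = complex_of_real (k x y)"
    and span_dense: "\<lbrakk>f \<in> H; e > 0\<rbrakk>
        \<Longrightarrow> \<exists>g\<in>module.span fscale (range (kernel_section k)). ip_norm ip (f - g) < e"
    and reproducing: "f \<in> H \<Longrightarrow> ip (kernel_section k x) f = f x"

text \<open>\<open>f = (\<Sum>y. g y)\<close> in the norm of \<open>ip\<close>, along the directed set of finite subsets of \<open>V\<close>.\<close>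

definition ip_has_sum :: "(('v \<Rightarrow> complex) \<Rightarrow> ('v \<Rightarrow> complex) \<Rightarrow> complex) \<Rightarrow>
    ('v \<Rightarrow> 'v \<Rightarrow> complex) \<Rightarrow> ('v \<Rightarrow> complex) \<Rightarrow> bool" where
  "ip_has_sum ip g f \<longleftrightarrow>
    ((\<lambda>F. ip_norm ip (f - (\<Sum>y\<in>F. g y))) \<longlongrightarrow> 0) (finite_subsets_at_top UNIV)"

definition mtranspose :: "('v \<Rightarrow> 'v \<Rightarrow> complex) \<Rightarrow> 'v \<Rightarrow> 'v \<Rightarrow> complex" where
  "mtranspose A = (\<lambda>x y. A y x)"

definition mident :: "'v \<Rightarrow> 'v \<Rightarrow> complex" where
  "mident = (\<lambda>x y. of_bool (x = y))"

text \<open>\<open>A B = P\<close> entrywise, including convergence of the series defining each entry.\<close>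

definition matrix_product_is ::
    "('v \<Rightarrow> 'v \<Rightarrow> complex) \<Rightarrow> ('v \<Rightarrow> 'v \<Rightarrow> complex) \<Rightarrow> ('v \<Rightarrow> 'v \<Rightarrow> complex) \<Rightarrow> bool" where
  "matrix_product_is A B P \<longleftrightarrow> (\<forall>x z. ((\<lambda>y. A x y * B y z) has_sum P x z) UNIV)"

definition is_matrix_inverse :: "('v \<Rightarrow> 'v \<Rightarrow> complex) \<Rightarrow> ('v \<Rightarrow> 'v \<Rightarrow> complex) \<Rightarrow> bool" where
  "is_matrix_inverse M A \<longleftrightarrow> matrix_product_is M A mident \<and> matrix_product_is A M mident"

end

theory Submission
  imports Defs
begin

text \<open>Pairing the expansion \<open>\<delta>\<^sub>x = (\<Sum>y. C\<^sub>x\<^sub>y k\<^sub>y)\<close> with \<open>f \<in> H\<close> is allowed by Cauchy--Schwarz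
  and gives \<open>\<langle>f, \<delta>\<^sub>x\<rangle> = (\<Sum>y. C\<^sub>x\<^sub>y cnj (f y))\<close>. The choice \<open>f = \<delta>\<^sub>z\<close> yields \<open>D = C\<^sup>t\<^sup>r\<close>, and
  \<open>f = k\<^sub>z\<close> yields \<open>K C\<^sup>t\<^sup>r = I\<close>. The remaining products follow by complex conjugation, since
  \<open>D\<close> is Hermitian and \<open>K\<close> is real and symmetric.\<close>

lemma module_fscale: "module (fscale :: complex \<Rightarrow> ('v \<Rightarrow> complex) \<Rightarrow> _)"
  unfolding module_iff_vector_space by (rule vector_space_fscale)

context function_hilbert_space
begin

lemma zero_mem: "0 \<in> H"
  using module.subspace_0[OF module_fscale subspace] .

lemma diff_mem: "f \<in> H \<Longrightarrow> g \<in> H \<Longrightarrow> f - g \<in> H"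
  using module.subspace_diff[OF module_fscale subspace] .

lemma scale_mem: "f \<in> H \<Longrightarrow> fscale c f \<in> H"
  using module.subspace_scale[OF module_fscale subspace] .

lemma sum_mem: "(\<And>y. y \<in> F \<Longrightarrow> g y \<in> H) \<Longrightarrow> sum g F \<in> H"
  using module.subspace_sum[OF module_fscale subspace] .

lemma ip_zero_right: "f \<in> H \<Longrightarrow> ip f 0 = 0"
  using ip_add_right[of f 0 0] zero_mem by simp

lemma ip_diff_right:
  assumes "f \<in> H" "g \<in> H" "h \<in> H"
  shows "ip f (g - h) = ip f g - ip f h"
  using ip_add_right[of f "g - h" h] assms diff_mem by simp

lemma ip_sum_right:
  assumes "f \<in> H" "\<And>y. g y \<in> H"
  shows "ip f (sum g F) = (\<Sum>y\<in>F. ip f (g y))"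
\<comment> \<open>For infinite \<open>F\<close> both sums are 0 by convention, so this case, like
  the empty one, comes down to \<open>ip f 0 = 0\<close>.\<close>
proof (induction F rule: infinite_finite_induct)
  case (insert y F)
  then show ?case
    using ip_add_right[OF assms(1,2) sum_mem[of F g, OF assms(2)]]
    by (simp only: sum.insert not_False_eq_True)
qed (simp_all only: sum.infinite sum.empty ip_zero_right[OF assms(1)] not_False_eq_True)

lemma ip_self: "f \<in> H \<Longrightarrow> ip f f = complex_of_real (Re (ip f f)) \<and> Re (ip f f) \<ge> 0"
  using ip_nonneg[of f] by (auto simp: complex_nonneg_Reals_iff complex_eq_iff)

text \<open>Removing from \<open>g\<close> its projection onto \<open>f\<close> leaves
  \<open>h\<close> orthogonal to \<open>f\<close>, and nonnegativity of \<open>ip h h\<close> is the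
  inequality.\<close>

lemma Cauchy_Schwarz:
  assumes f: "f \<in> H" and g: "g \<in> H"
  shows "norm (ip f g) \<le> ip_norm ip f * ip_norm ip g"
proof (cases "f = 0")
  case True
  then have "ip f g = 0"
    using ip_commute[OF g zero_mem] ip_zero_right[OF g] by simp
  then show ?thesis
    using ip_self[OF f] ip_self[OF g] by (simp add: ip_norm_def)
next
  case False
  define a where "a = Re (ip f f)"
  have ff: "ip f f = complex_of_real a" and "a \<noteq> 0" "a \<ge> 0"
    using ip_self[OF f] ip_eq_zero[OF f] False by (auto simp: a_def)
  then have a: "a > 0" by simp
  \<comment> \<open>This coefficient is forced by requiring
    \<open>ip f (g - fscale c f) = 0\<close>.\<close>
  define c where "c = ip f g / ip f f"
  define h where "h = g - fscale c f"
  have h: "h \<in> H"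
    unfolding h_def using f g diff_mem scale_mem by blast
  have right: "ip u h = ip u g - c * ip u f" if "u \<in> H" for u
    unfolding h_def using that f g by (simp add: ip_diff_right ip_scale_right scale_mem)
  have "ip f h = 0"
    using right[OF f] ff a by (simp add: c_def)
  then have "ip h f = 0"
    using ip_commute[OF f h] by simp
  \<comment> \<open>By orthogonality the \<open>f\<close>-part of \<open>h\<close> drops out,
    leaving \<open>ip h g\<close>.\<close>
  then have "ip h h = cnj (ip g h)"
    using right[OF h] ip_commute[OF g h] by simp
  also have "\<dots> = cnj (ip g g - ip f g * cnj (ip f g) / a)"
    using right[OF g] ip_commute[OF f g] by (simp add: c_def ff)
  finally have "Re (ip h h) = Re (ip g g) - (norm (ip f g))\<^sup>2 / a"
    by (simp add: complex_norm_square[symmetric] flip: of_real_power of_real_divide)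
  then have "(norm (ip f g))\<^sup>2 / a \<le> Re (ip g g)"
    using ip_self[OF h] by linarith
  then have "(norm (ip f g))\<^sup>2 \<le> a * Re (ip g g)"
    using a by (simp add: field_simps)
  then show ?thesis
    by (simp add: ip_norm_def a_def real_le_rsqrt flip: real_sqrt_mult)
qed

text \<open>Pairing with a fixed \<open>f\<close> is norm-continuous: Cauchy-Schwarz bounds the
  error of each partial sum by \<open>ip_norm ip f\<close> times its norm error.\<close>

lemma ip_has_sum_right:
  assumes sum: "ip_has_sum ip g h" and f: "f \<in> H" and g: "\<And>y. g y \<in> H" and h: "h \<in> H"
  shows "((\<lambda>y. ip f (g y)) has_sum ip f h) UNIV"
proof -
  have bound: "norm (ip f h - (\<Sum>y\<in>F. ip f (g y))) \<le> ip_norm ip f * ip_norm ip (h - sum g F)" for F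
    using Cauchy_Schwarz[OF f diff_mem[OF h sum_mem[of F g]]] f g h
    by (simp add: ip_diff_right ip_sum_right sum_mem)
  have "((\<lambda>F. ip_norm ip f * ip_norm ip (h - sum g F)) \<longlongrightarrow> 0) (finite_subsets_at_top UNIV)"
    using tendsto_mult_right_zero sum unfolding ip_has_sum_def by blast
  then have "((\<lambda>F. ip f h - (\<Sum>y\<in>F. ip f (g y))) \<longlongrightarrow> 0) (finite_subsets_at_top UNIV)"
    by (rule Lim_null_comparison[rotated]) (simp add: bound)
  then have "((\<lambda>F. ip f h - (ip f h - (\<Sum>y\<in>F. ip f (g y)))) \<longlongrightarrow> ip f h - 0)
      (finite_subsets_at_top UNIV)"
    by (intro tendsto_diff tendsto_const)
  then show ?thesis
    by (simp add: has_sum_def)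
qed

end

lemma (in rkhs) kernel_symmetric: "k x y = k y x"
  using ip_commute[OF section_mem section_mem, of x y] by (simp add: ip_sections)

text \<open>Linearity in the second argument leaves \<open>c y\<close> unconjugated;
  \<open>f y\<close> is conjugated because the reproducing property has the section in the first
  argument.\<close>

lemma (in rkhs) ip_section_expansion:
  assumes "ip_has_sum ip (\<lambda>y. fscale (c y) (kernel_section k y)) h" "f \<in> H" "h \<in> H"
  shows "((\<lambda>y. c y * cnj (f y)) has_sum ip f h) UNIV"
proof -
  have "ip f (fscale (c y) (kernel_section k y)) = c y * cnj (f y)" for y
    using assms(2) ip_commute[OF section_mem assms(2)]
    by (simp add: ip_scale_right section_mem reproducing)
  then show ?thesis
    using ip_has_sum_right[OF assms(1,2) scale_mem[OF section_mem] assms(3)] by simp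
qed

theorem corollary4p15:
  fixes k :: "'v :: countable \<Rightarrow> 'v \<Rightarrow> real"
    and H :: "('v \<Rightarrow> complex) set"
    and ip :: "('v \<Rightarrow> complex) \<Rightarrow> ('v \<Rightarrow> complex) \<Rightarrow> complex"
    and C D K :: "'v \<Rightarrow> 'v \<Rightarrow> complex"
  assumes "infinite (UNIV :: 'v set)"
    and "positive_definite_kernel k"
    and "rkhs k H ip"
    and "\<And>x. delta x \<in> H"
    and "\<And>x y. D x y = ip (delta x) (delta y)"
    and "\<And>x y. K x y = complex_of_real (k x y)"
    and "\<And>x. ip_has_sum ip (\<lambda>y. fscale (C x y) (kernel_section k y)) (delta x)"
  shows "D = mtranspose C \<and> is_matrix_inverse (mtranspose C) (mtranspose K) \<and>
    is_matrix_inverse (mtranspose C) K"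
proof -
  interpret rkhs k H ip by fact
  note \<delta>_mem = assms(4) and D_eq = assms(5) and K_eq = assms(6) and expansion = assms(7)
  have D_C: "D z x = C x z" for x z
  proof -
    have "((\<lambda>y. C x y * cnj (delta z y)) has_sum D z x) UNIV"
      using ip_section_expansion[OF expansion \<delta>_mem \<delta>_mem] by (simp add: D_eq)
    \<comment> \<open>Only the term \<open>y = z\<close> is nonzero.\<close>
    moreover have "((\<lambda>y. C x y * cnj (delta z y)) has_sum C x z) UNIV"
      by (rule has_sum_finite_neutralI[where B = "{z}"]) (auto simp: delta_def)
    ultimately show ?thesis
      by (rule has_sum_unique)
  qed
  \<comment> \<open>\<open>D\<close> is a Gram matrix, hence Hermitian, and \<open>D_C\<close>
    carries this over to \<open>C\<close>.\<close>
  have C_hermitian: "C y x = cnj (C x y)" for x y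
    using ip_commute[OF \<delta>_mem \<delta>_mem, of y x] by (simp flip: D_eq add: D_C)
  have K_sym: "K x y = K y x" for x y
    by (simp add: K_eq kernel_symmetric[of x y])
  have KC: "((\<lambda>y. K x y * C z y) has_sum mident x z) UNIV" for x z
  proof -
    have "C z y * cnj (kernel_section k x y) = K x y * C z y" for y
      by (simp add: kernel_section_def K_eq kernel_symmetric[of x y])
    moreover have "delta z x = mident x z"
      by (simp add: delta_def mident_def)
    ultimately show ?thesis
      using ip_section_expansion[OF expansion section_mem \<delta>_mem, of z x]
      by (simp only: reproducing[OF \<delta>_mem])
  qed
  have CK: "((\<lambda>y. C y x * K y z) has_sum mident x z) UNIV" for x z
  proof -
    \<comment> \<open>Conjugating \<open>KC\<close> with the outer indices exchanged turns
      \<open>C x y\<close> into \<open>C y x\<close>, which reverses the order of the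
      product.\<close>
    have "((\<lambda>y. cnj (K z y * C x y)) has_sum cnj (mident z x)) UNIV"
      using KC by (subst has_sum_cnj_iff)
    moreover have "cnj (K z y * C x y) = C y x * K y z" for y
      using K_sym[of z y] C_hermitian[of y x] by (simp add: K_eq mult.commute)
    moreover have "cnj (mident z x) = mident x z"
      by (auto simp: mident_def)
    ultimately show ?thesis
      by (simp only:)
  qed
  \<comment> \<open>By symmetry of the kernel the two inverse claims coincide.\<close>
  have K_tr: "mtranspose K = K"
    by (simp add: mtranspose_def fun_eq_iff K_sym)
  have "is_matrix_inverse (mtranspose C) K"
    using KC CK by (simp add: is_matrix_inverse_def matrix_product_is_def mtranspose_def)
  then show ?thesis
    unfolding K_tr by (simp add: fun_eq_iff mtranspose_def D_C)
qed

end
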